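(* For all $k\in\mathbb{Z}^+$, we have $CF(k;2)\ge 6$.
   Context: Identify $[k]$ with the alphabet $\{0,1,\dots,k-1\}$. A cg-word of length $n$ is a word $v(x)$ of length $n$ over the alphabet $\{0,1,\dots,k-1,x,k-1-x\}$ (where $x$ and $k-1-x$ are formal symbols) in which the symbol $x$ occurs at least once (the symbol $k-1-x$ need not occur). For $a\in\{0,\dots,k-1\}$, $v(a)\in\{0,\dots,k-1\}^n$ is obtained by replacing each symbol $x$ by $a$ and each symbol $k-1-x$ by the number $k-1-a$. The cg-line determined by $v$ is the sequence $v(0),v(1),\dots,v(k-1)$. A partial cg-line of length $m$ is a set of $m$ consecutive points $v(i),v(i+1),\dots,v(i+m-1)$ of a cg-line, where $0\le i\le k-m$. The Connect Four number $CF(k;r)$ is the minimal dimension $d$ such that for every $n\ge d$, every $r$-coloring of the points of $[k]^n$ admits a monochromatic partial cg-line of length $4$; if no such $d$ exists (as for $k<4$, where there are no partial cg-lines of length $4$), $CF(k;r)$ is taken to be $\infty$. *)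

theory Defs
  imports Main "HOL-Library.Extended_Nat" "HOL-Library.FuncSet"
begin

text \<open>\<open>X\<close> is the formal symbol \<open>x\<close> and \<open>Xbar\<close> is the formal symbol \<open>k - 1 - x\<close>.\<close>

datatype cg_symbol = Const nat | X | Xbar

definition cube :: "nat \<Rightarrow> nat \<Rightarrow> nat list set" where
  "cube k n = {p. length p = n \<and> set p \<subseteq> {..<k}}"

definition is_cg_word :: "nat \<Rightarrow> nat \<Rightarrow> cg_symbol list \<Rightarrow> bool" where
  "is_cg_word k n v \<longleftrightarrow>
     length v = n \<and> set v \<subseteq> Const ` {..<k} \<union> {X, Xbar} \<and> X \<in> set v"

text \<open>Only used for \<open>a < k\<close>, so the subtraction on \<^typ>\<open>nat\<close> does not truncate.\<close>

fun subst_symbol :: "nat \<Rightarrow> nat \<Rightarrow> cg_symbol \<Rightarrow> nat" where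
  "subst_symbol k a (Const c) = c"
| "subst_symbol k a X = a"
| "subst_symbol k a Xbar = k - 1 - a"

definition cg_point :: "nat \<Rightarrow> cg_symbol list \<Rightarrow> nat \<Rightarrow> nat list" where
  "cg_point k v a = map (subst_symbol k a) v"

definition partial_cg_line :: "nat \<Rightarrow> nat \<Rightarrow> nat \<Rightarrow> nat list set \<Rightarrow> bool" where
  "partial_cg_line k n m L \<longleftrightarrow>
     (\<exists>v i. is_cg_word k n v \<and> i + m \<le> k \<and> L = cg_point k v ` {i..<i + m})"

definition monochromatic :: "('a \<Rightarrow> nat) \<Rightarrow> 'a set \<Rightarrow> bool" where
  "monochromatic f L \<longleftrightarrow> (\<exists>c. \<forall>p\<in>L. f p = c)"

text \<open>On \<^typ>\<open>enat\<close> the infimum of a nonempty set is its minimum, and the infimum of the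
  empty set is \<open>\<infinity>\<close>.\<close>

definition CF :: "nat \<Rightarrow> nat \<Rightarrow> enat" where
  "CF k r = Inf {enat d | d. \<forall>n\<ge>d. \<forall>f \<in> cube k n \<rightarrow> {..<r}.
                   \<exists>L. partial_cg_line k n 4 L \<and> monochromatic f L}"

end

theory Submission
  imports Defs
begin

text \<open>
  The dimension \<open>5\<close> is avoided by one explicit two-colouring of \<open>[k]\<^sup>5\<close>, given by a formula
  that works uniformly in \<open>k\<close>; this excludes every \<open>d \<le> 5\<close> as a value of the Connect Four
  number.

  Each coordinate value \<open>a\<close> is reduced to two bits. Let \<open>\<delta> = 2a - (k - 1)\<close> modulo \<open>8\<close>. A step
  along a line changes \<open>\<delta>\<close> by \<open>2\<close>, and replacing \<open>a\<close> by \<open>k - 1 - a\<close> changes \<open>\<delta>\<close> to \<open>-\<delta>\<close>.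
  The first bit, \<open>inner\<close>, is constant on the pairs \<open>{\<delta>, -\<delta>}\<close>, hence the same for \<open>x\<close> and
  \<open>k - 1 - x\<close>. The second bit, \<open>upper\<close>, is \<open>\<delta> \<ge> 4\<close>. The point is that among any four
  consecutive values of \<open>x\<close>, each value of the inner bit is taken twice, and between these two
  positions the upper bits of both \<open>x\<close> and \<open>k - 1 - x\<close> flip (\<open>window_pair\<close>).

  Let \<open>T\<close> be the set of inner coordinates of a point. The colour is a sum over GF(2) of the
  upper bits of the coordinates in a set \<open>U(T)\<close>. On a partial line, let \<open>A\<close> be the nonempty set
  of moving coordinates and \<open>S\<close> the set of fixed inner ones. Then \<open>T\<close> is \<open>S\<close> at two of the
  four points and \<open>S \<union> A\<close> at the other two. The two points with a common \<open>T\<close> have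
  upper bits that differ exactly on \<open>A\<close>, so their colours differ as soon as \<open>U(T) \<inter> A\<close> has an
  odd number of elements. It remains to have a family \<open>U\<close> such that for all disjoint \<open>S\<close> and
  \<open>A \<noteq> {}\<close> the set \<open>U(S) \<inter> A\<close> or the set \<open>U(S \<union> A) \<inter> A\<close> has odd size. For five
  coordinates there is one; it is tabulated in \<open>mask_table\<close>, and \<open>mask_odd\<close> states the property.
\<close>

definition phase :: "nat \<Rightarrow> nat \<Rightarrow> int" where
  "phase k a = (2 * int a - int k + 1) mod 8"

definition inner :: "nat \<Rightarrow> nat \<Rightarrow> bool" where
  "inner k a \<longleftrightarrow> phase k a \<in> {2, 3, 5, 6}"

definition upper :: "nat \<Rightarrow> nat \<Rightarrow> bool" where
  "upper k a \<longleftrightarrow> phase k a \<ge> 4"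

lemma phase_add: "phase k (a + j) = (phase k a + 2 * int j) mod 8"
  unfolding phase_def by (simp add: mod_simps algebra_simps)

lemma phase_reflect:
  assumes "a < k"
  shows "phase k (k - 1 - a) = (- phase k a) mod 8"
  using assms unfolding phase_def by (simp add: of_nat_diff mod_simps algebra_simps)

lemma inner_reflect:
  assumes "a < k"
  shows "inner k (k - 1 - a) = inner k a"
proof -
  have "phase k a \<in> {0..<8}"
    by (simp add: phase_def)
  then have "phase k a \<in> {0, 1, 2, 3, 4, 5, 6, 7}"
    by auto
  then show ?thesis
    unfolding inner_def phase_reflect[OF assms] by auto
qed

text \<open>
  The values of the phase in a window are four consecutive residues of the same parity. For
  odd \<open>k\<close> they are \<open>0, 2, 4, 6\<close> in cyclic order, with equal inner bits at \<open>0, 4\<close> and at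
  \<open>2, 6\<close>; for even \<open>k\<close> they are \<open>1, 3, 5, 7\<close>, with equal inner bits at \<open>1, 7\<close> and at \<open>3, 5\<close>.
  Each of these four pairs is mapped to itself by negation modulo \<open>8\<close> and has exactly one
  element that is at least \<open>4\<close>.
\<close>

lemma window_pair:
  assumes "i + 4 \<le> k"
  obtains a a' where "a \<in> {i..<i + 4}" "a' \<in> {i..<i + 4}"
    "inner k a = b" "inner k a' = b"
    "upper k a \<noteq> upper k a'" "upper k (k - 1 - a) \<noteq> upper k (k - 1 - a')"
proof -
  have "phase k i \<in> {0..<8}"
    by (simp add: phase_def)
  then have *: "phase k i \<in> {0, 1, 2, 3, 4, 5, 6, 7}"
    by auto
  \<comment> \<open>Expressed through the phase at \<open>i\<close> alone, the claim becomes a check of eight residues.\<close>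
  define inn where "inn = (\<lambda>r :: int. r mod 8 \<in> {2, 3, 5, 6})"
  define upp where "upp = (\<lambda>r :: int. r mod 8 \<ge> 4)"
  have at: "inner k (i + j) = inn (phase k i + 2 * int j)"
    "upper k (i + j) = upp (phase k i + 2 * int j)"
    "upper k (k - 1 - (i + j)) = upp (- (phase k i + 2 * int j))"
    if "j \<in> {0, 1, 2, 3}" for j
  proof -
    show "inner k (i + j) = inn (phase k i + 2 * int j)"
      "upper k (i + j) = upp (phase k i + 2 * int j)"
      unfolding inner_def upper_def inn_def upp_def phase_add by simp_all
    have "i + j < k"
      using assms that by auto
    then show "upper k (k - 1 - (i + j)) = upp (- (phase k i + 2 * int j))"
      unfolding upper_def upp_def by (simp only: phase_reflect phase_add mod_minus_eq)
  qed
  have "\<exists>j\<in>{0, 1, 2, 3}. \<exists>l\<in>{0, 1, 2, 3}.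
      inn (phase k i + 2 * int j) = b \<and> inn (phase k i + 2 * int l) = b \<and>
      upp (phase k i + 2 * int j) \<noteq> upp (phase k i + 2 * int l) \<and>
      upp (- (phase k i + 2 * int j)) \<noteq> upp (- (phase k i + 2 * int l))"
    using * unfolding inn_def upp_def by (elim insertE emptyE; cases b; simp)
  then obtain j l where "j \<in> {0, 1, 2, 3}" "l \<in> {0, 1, 2, 3}"
    "inner k (i + j) = b" "inner k (i + l) = b" "upper k (i + j) \<noteq> upper k (i + l)"
    "upper k (k - 1 - (i + j)) \<noteq> upper k (k - 1 - (i + l))"
    using at by metis
  then show ?thesis
    using that[of "i + j" "i + l"] by auto
qed

text \<open>
  The family \<open>U\<close>, found by a satisfiability search restricted to families that are invariant under
  complementing \<open>T\<close> and equivariant under rotating the coordinates \<open>0, 1, 2\<close>. By the first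
  symmetry only the sets \<open>T\<close> without the coordinate \<open>4\<close> need a row.
\<close>

definition mask_table :: "(nat list \<times> nat list) list" where
  "mask_table =
    [([],        [4]),          ([3],          [0, 1, 2, 3]),
     ([0],       [0, 2, 3]),    ([0, 3],       [1, 3, 4]),
     ([1],       [0, 1, 3]),    ([1, 3],       [2, 3, 4]),
     ([2],       [1, 2, 3]),    ([2, 3],       [0, 3, 4]),
     ([0, 1],    [1, 3, 4]),    ([0, 1, 3],    [0, 2, 4]),
     ([1, 2],    [2, 3, 4]),    ([1, 2, 3],    [0, 1, 4]),
     ([0, 2],    [0, 3, 4]),    ([0, 2, 3],    [1, 2, 4]),
     ([0, 1, 2], [0, 1, 2, 4]), ([0, 1, 2, 3], [3, 4])]"

text \<open>
  The key looked up is \<open>T\<close> or its complement, whichever does not contain \<open>4\<close>. It is a sorted list,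
  so it occurs in the table in exactly this form.
\<close>

definition mask :: "bool list \<Rightarrow> nat list" where
  "mask t = the (map_of mask_table [i \<leftarrow> [0..<4]. t ! i \<noteq> t ! 4])"

text \<open>
  The inner bits along a line form a word in which \<open>None\<close> stands for a moving coordinate.
  At a position whose own inner bit is \<open>b\<close>, all moving coordinates have inner bit \<open>b\<close>.
\<close>

definition fill :: "bool \<Rightarrow> bool option list \<Rightarrow> bool list" where
  "fill b w = map (case_option b id) w"

text \<open>
  The required property of \<open>U\<close>, as an evaluation over the \<open>3\<^sup>5\<close> words that describe a pair of
  disjoint sets \<open>S\<close> and \<open>A\<close>.
\<close>

lemma mask_odd_n_lists:
  "\<forall>w \<in> set (List.n_lists 5 [None, Some False, Some True]). None \<in> set w \<longrightarrow>
     odd (length [i \<leftarrow> mask (fill False w). w ! i = None]) \<or>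
     odd (length [i \<leftarrow> mask (fill True w). w ! i = None])"
  by code_simp

lemma mask_odd:
  assumes "length w = 5" "None \<in> set w"
  obtains b where "odd (length [i \<leftarrow> mask (fill b w). w ! i = None])"
proof -
  have "x \<in> {None, Some False, Some True}" for x :: "bool option"
    by (cases x) auto
  then have "w \<in> set (List.n_lists 5 [None, Some False, Some True])"
    using assms(1) by (auto simp: set_n_lists)
  then show ?thesis
    using mask_odd_n_lists assms(2) that by blast
qed

lemma mask_less:
  assumes "length t = 5" "i \<in> set (mask t)"
  shows "i < 5"
proof -
  have "\<forall>t \<in> set (List.n_lists 5 [False, True]). \<forall>i \<in> set (mask t). i < 5"
    by code_simp
  moreover have "t \<in> set (List.n_lists 5 [False, True])"
    using assms(1) by (auto simp: set_n_lists)
  ultimately show ?thesis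
    using assms(2) by blast
qed

definition colour :: "nat \<Rightarrow> nat list \<Rightarrow> nat" where
  "colour k p = length [i \<leftarrow> mask (map (inner k) p). upper k (p ! i)] mod 2"

lemma odd_length_filter_xor:
  "odd (length [i \<leftarrow> us. P i \<noteq> Q i]) \<longleftrightarrow>
     odd (length [i \<leftarrow> us. P i]) \<noteq> odd (length [i \<leftarrow> us. Q i])"
  by (induction us) auto

text \<open>
  The property of \<open>U\<close> says which inner bit \<open>b\<close> to look at, and the window then provides two
  positions with that inner bit whose colours differ.
\<close>

lemma colour_not_monochromatic:
  assumes "partial_cg_line k 5 4 L"
  shows "\<not> monochromatic (colour k) L"
proof
  assume mono: "monochromatic (colour k) L"
  obtain v i where v: "is_cg_word k 5 v" and i: "i + 4 \<le> k"
    and L: "L = cg_point k v ` {i..<i + 4}"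
    using assms unfolding partial_cg_line_def by blast
  define w where
    "w = map (\<lambda>z. case z of Const c \<Rightarrow> Some (inner k c) | _ \<Rightarrow> None) v"
  have len: "length v = 5" "length w = 5" and "None \<in> set w"
    using v by (force simp: w_def is_cg_word_def)+
  then obtain b where b: "odd (length [j \<leftarrow> mask (fill b w). w ! j = None])"
    using mask_odd by blast
  obtain a a' where a: "a \<in> {i..<i + 4}" "a' \<in> {i..<i + 4}"
    and inner: "inner k a = b" "inner k a' = b"
    and upper: "upper k a \<noteq> upper k a'" "upper k (k - 1 - a) \<noteq> upper k (k - 1 - a')"
    using window_pair[OF i] by metis
  have less: "a < k" "a' < k"
    using a i by auto
  have inner_line: "map (inner k) (cg_point k v c) = fill b w"
    if "inner k c = b" "c < k" for c
    unfolding cg_point_def fill_def w_def map_map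
  proof (intro map_cong refl)
    fix z
    show "(inner k \<circ> subst_symbol k c) z =
        (case_option b id \<circ> (\<lambda>z. case z of Const c \<Rightarrow> Some (inner k c) | _ \<Rightarrow> None)) z"
      using that inner_reflect[of c k] by (cases z) auto
  qed
  \<comment> \<open>Between the two positions the upper bits flip exactly at the moving coordinates.\<close>
  have upper_line: "upper k (cg_point k v a ! j) \<noteq> upper k (cg_point k v a' ! j) \<longleftrightarrow> w ! j = None"
    if "j < 5" for j
    using that upper len by (cases "v ! j") (auto simp: cg_point_def w_def)
  have "[j \<leftarrow> mask (fill b w).
          upper k (cg_point k v a ! j) \<noteq> upper k (cg_point k v a' ! j)] =
      [j \<leftarrow> mask (fill b w). w ! j = None]"
    using mask_less[of "fill b w"] upper_line len by (intro filter_cong) (auto simp: fill_def)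
  then have "odd (length [j \<leftarrow> mask (fill b w). upper k (cg_point k v a ! j)]) \<noteq>
      odd (length [j \<leftarrow> mask (fill b w). upper k (cg_point k v a' ! j)])"
    using b odd_length_filter_xor by metis
  then have "colour k (cg_point k v a) \<noteq> colour k (cg_point k v a')"
    unfolding colour_def inner_line[OF inner(1) less(1)] inner_line[OF inner(2) less(2)]
    by presburger
  then show False
    using mono a unfolding monochromatic_def L by (metis image_eqI)
qed

theorem theorem25:
  fixes k :: nat
  assumes "k > 0"
  shows "CF k 2 \<ge> 6"
  unfolding CF_def
proof (rule Inf_greatest)
  fix e
  assume "e \<in> {enat d | d. \<forall>n\<ge>d. \<forall>f \<in> cube k n \<rightarrow> {..<2}.
      \<exists>L. partial_cg_line k n 4 L \<and> monochromatic f L}"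
  then obtain d where e: "e = enat d"
    and d: "\<And>n f. n \<ge> d \<Longrightarrow> f \<in> cube k n \<rightarrow> {..<2} \<Longrightarrow>
      \<exists>L. partial_cg_line k n 4 L \<and> monochromatic f L"
    by blast
  \<comment> \<open>The condition on \<open>d\<close> covers all dimensions from \<open>d\<close> on, so the colouring in dimension \<open>5\<close>
    refutes every smaller \<open>d\<close> as well.\<close>
  have "\<not> d \<le> 5"
    using d[of 5 "colour k"] colour_not_monochromatic by (auto simp: colour_def)
  then show "6 \<le> e"
    unfolding e by (simp add: numeral_eq_enat)
qed

end
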